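(* Let $A,B$ be integers such that $|A|$ and $|B|$ are primes and (1) $A\equiv 1 \pmod 8$ and $B\equiv 3\pmod 8$; (2) $A+B\ge 0$ or $AB<0$. Let $r$ be any prime number coprime to $AB(A-B)$ satisfying the following three conditions: (i) $r\equiv 7\pmod 8$; (ii) $\left(\frac{A}{r}\right)=\left(\frac{B}{r}\right)=-1$; (iii) for every odd prime $p\mid (A-B)$, one has $\left(\frac{-Br}{p}\right)=-1$. Then the elliptic curve $E^{A,B}_r: y^2=x(x+Ar)(x+Br)$ over $\mathbb{Q}$ has Mordell-Weil rank $0$, i.e. $r_{E^{A,B}_r}=0$.
   Context: $\left(\frac{\cdot}{\cdot}\right)$ denotes the Legendre symbol. For integers $A,B$, $E^{A,B}$ is the elliptic curve over $\mathbb{Q}$ given by $y^2=x(x+A)(x+B)$. For a square-free integer $d$, the $d$-th quadratic twist of $y^2=x^3+ax^2+bx+c$ is $y^2=x^3+adx^2+bd^2x+cd^3$; thus the $r$-th twist of $E^{A,B}$ is $E^{A,B}_r: y^2=x(x+Ar)(x+Br)$. For an elliptic curve $E$ over $\mathbb{Q}$, $r_E$ denotes the rank of the Mordell-Weil group $E(\mathbb{Q})$. *)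

theory Defs
  imports "HOL-Number_Theory.Number_Theory" "HOL-Library.Extended_Nat"
begin

section \<open>Curves y^2 = x^3 + a x^2 + b x + c and their groups of rational points\<close>

text \<open>\<open>Cubic a b c\<close> stands for the curve \<open>y^2 = x^3 + a x^2 + b x + c\<close>.\<close>

datatype 'a cubic_curve = Cubic (coeff_a: 'a) (coeff_b: 'a) (coeff_c: 'a)

definition cubic_rhs :: "'a::field cubic_curve \<Rightarrow> 'a \<Rightarrow> 'a" where
  "cubic_rhs E x = x ^ 3 + coeff_a E * x ^ 2 + coeff_b E * x + coeff_c E"

definition cubic_discr :: "'a::field cubic_curve \<Rightarrow> 'a" where
  "cubic_discr E = (let a = coeff_a E; b = coeff_b E; c = coeff_c E in
     a ^ 2 * b ^ 2 - 4 * b ^ 3 - 4 * a ^ 3 * c - 27 * c ^ 2 + 18 * a * b * c)"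

definition is_elliptic_curve :: "'a::field_char_0 cubic_curve \<Rightarrow> bool" where
  "is_elliptic_curve E \<longleftrightarrow> cubic_discr E \<noteq> 0"

datatype 'a point = At_Infinity | Affine 'a 'a

fun on_curve :: "'a::field cubic_curve \<Rightarrow> 'a point \<Rightarrow> bool" where
  "on_curve E At_Infinity \<longleftrightarrow> True"
| "on_curve E (Affine x y) \<longleftrightarrow> y ^ 2 = cubic_rhs E x"

text \<open>The chord-tangent law: \<open>m\<close> is the slope of the line through the two points (of the
  tangent if they coincide), and the third intersection point is reflected in the x-axis.\<close>

fun point_add :: "'a::field cubic_curve \<Rightarrow> 'a point \<Rightarrow> 'a point \<Rightarrow> 'a point" where
  "point_add E At_Infinity Q = Q"
| "point_add E (Affine x1 y1) At_Infinity = Affine x1 y1"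
| "point_add E (Affine x1 y1) (Affine x2 y2) =
    (if x1 = x2 \<and> y1 = - y2 then At_Infinity
     else let m = (if x1 = x2 then (3 * x1 ^ 2 + 2 * coeff_a E * x1 + coeff_b E) / (2 * y1)
                   else (y2 - y1) / (x2 - x1));
              x3 = m ^ 2 - coeff_a E - x1 - x2
          in Affine x3 (m * (x1 - x3) - y1))"

text \<open>The group is written multiplicatively: the \<open>n\<close>-th multiple of a point is its \<open>n\<close>-th power.\<close>

definition mordell_weil_group :: "rat cubic_curve \<Rightarrow> rat point monoid" where
  "mordell_weil_group E =
     \<lparr>carrier = {P. on_curve E P}, monoid.mult = point_add E, one = At_Infinity\<rparr>"

section \<open>Rank of an abelian group\<close>

definition independent_in :: "('a, 'b) monoid_scheme \<Rightarrow> 'a set \<Rightarrow> bool" where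
  "independent_in G S \<longleftrightarrow> finite S \<and> S \<subseteq> carrier G \<and>
     (\<forall>n :: 'a \<Rightarrow> int. finprod G (\<lambda>P. P [^]\<^bsub>G\<^esub> n P) S = \<one>\<^bsub>G\<^esub> \<longrightarrow> (\<forall>P\<in>S. n P = 0))"

text \<open>The supremum is taken in the extended naturals, so a group with independent sets of
  unbounded size has rank \<open>\<infinity>\<close>, never a junk value.\<close>

definition abelian_group_rank :: "('a, 'b) monoid_scheme \<Rightarrow> enat" where
  "abelian_group_rank G = (SUP S\<in>{S. independent_in G S}. enat (card S))"

definition mordell_weil_rank :: "rat cubic_curve \<Rightarrow> enat" where
  "mordell_weil_rank E = abelian_group_rank (mordell_weil_group E)"

section \<open>The curves E^{A,B} and their quadratic twists\<close>

definition quadratic_twist :: "int \<Rightarrow> rat cubic_curve \<Rightarrow> rat cubic_curve" where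
  "quadratic_twist d E =
     Cubic (coeff_a E * of_int d) (coeff_b E * of_int d ^ 2) (coeff_c E * of_int d ^ 3)"

text \<open>\<open>x (x + A) (x + B) = x^3 + (A + B) x^2 + A B x\<close>.\<close>

definition E_curve :: "int \<Rightarrow> int \<Rightarrow> rat cubic_curve" where
  "E_curve A B = Cubic (of_int (A + B)) (of_int (A * B)) 0"

lemma on_curve_twist_iff:
  "on_curve (quadratic_twist r (E_curve A B)) (Affine x y) \<longleftrightarrow>
     y ^ 2 = x * (x + of_int (A * r)) * (x + of_int (B * r))"
  by (simp add: quadratic_twist_def E_curve_def cubic_rhs_def power2_eq_square power3_eq_cube
      algebra_simps)

lemma is_elliptic_curve_twist:
  assumes "A \<noteq> 0" "B \<noteq> 0" "A \<noteq> B" "r \<noteq> 0"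
  shows "is_elliptic_curve (quadratic_twist r (E_curve A B))"
proof -
  have "cubic_discr (quadratic_twist r (E_curve A B)) =
      (of_int (A * B * (A - B)) * of_int r ^ 3) ^ 2"
    by (simp add: cubic_discr_def quadratic_twist_def E_curve_def Let_def
        power2_eq_square power3_eq_cube algebra_simps)
  then show ?thesis
    using assms by (simp add: is_elliptic_curve_def)
qed

end

theory Submission
  imports Defs "HOL-Computational_Algebra.Nth_Powers" "HOL-Computational_Algebra.Squarefree"
begin

text \<open>
  Write \<open>a = A r\<close> and \<open>b = B r\<close>. The theorem holds because the only rational points of
  \<open>y^2 = x (x + a) (x + b)\<close> are the four points of order dividing 2, so that \<open>P + P\<close> is the
  point at infinity \<open>O\<close> for every \<open>P\<close>. Such a group has no nonempty independent set, because
  \<open>\<Sum>P\<in>S. 2 P = O\<close> is a nontrivial relation (\<open>rank_zero_if_exponent_two\<close>).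

  That there is no point with \<open>y \<noteq> 0\<close> is shown by a complete 2-descent followed by a
  2-adic infinite descent.

  The 2-descent looks at \<open>x\<close>, \<open>x + a\<close>, \<open>x + b\<close> modulo rational squares. The square class of
  \<open>x\<close> is that of a divisor of \<open>A B r\<close>, up to sign. Adding a point of order 2 multiplies
  this class by \<open>A B\<close>, \<open>- A r\<close> or \<open>- B r\<close>, so after such a translation it is the class of \<open>1\<close>,
  \<open>-1\<close>, \<open>A\<close> or \<open>- A\<close> (\<open>translate_square_class\<close>). The classes \<open>-1\<close> and \<open>- A\<close> are congruent to
  \<open>7\<close> modulo \<open>8\<close> and impossible over the 2-adic numbers (\<open>two_adic_obstruction\<close>); the class \<open>A\<close>
  is impossible over the \<open>r\<close>-adic numbers, because \<open>A\<close> and \<open>B\<close> are non-residues modulo \<open>r\<close>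
  (\<open>r_adic_obstruction\<close>). If \<open>x\<close> is a square, then \<open>x + a\<close> and \<open>x + b\<close> share a square class,
  and the condition at the primes dividing \<open>A - B\<close>, the signs of \<open>A\<close> and \<open>B\<close>, and congruences modulo \<open>r\<close> and modulo powers of
  \<open>2\<close> leave only the trivial class (\<open>trivial_square_class\<close>). Hence every point with \<open>y \<noteq> 0\<close>
  has a translate by a point of order at most 2 for which all three of \<open>x\<close>, \<open>x + a\<close>, \<open>x + b\<close>
  are squares.

  The infinite descent starts from such a point, with \<open>x = (z / w)^2\<close> in lowest terms.
  It is the double of a rational point (\<open>halving\<close>), and that point may be replaced by
  a translate with the same double, whose \<open>x\<close>-coordinate is again of the form \<open>(z' / w')^2\<close>
  with all three expressions square. Congruences modulo \<open>8\<close> force \<open>w'\<close> to be even, and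
  then the duplication formula shows that \<open>w\<close> has one more factor \<open>2\<close> than \<open>w'\<close>: doubling moves
  such points 2-adically closer to \<open>O\<close>. Since each of them can be halved indefinitely, every
  power of \<open>2\<close> divides \<open>w\<close> (\<open>power_two_dvd_denominator\<close>), which is absurd.
\<close>

section \<open>Groups of exponent two have rank zero\<close>

lemma foldSetD_neutral:
  assumes "(S, z) \<in> foldSetD D f e" "\<And>P. P \<in> S \<Longrightarrow> f P e = e"
  shows "z = e"
  using assms by (induction rule: foldSetD.induct) auto

text \<open>The product is a fold over the elements of \<open>S\<close> in an arbitrary order; here every
  intermediate value is the neutral element, whatever the order.\<close>

lemma finprod_neutral:
  assumes "finite S" and one: "\<one>\<^bsub>G\<^esub> \<in> carrier G" "\<one>\<^bsub>G\<^esub> \<otimes>\<^bsub>G\<^esub> \<one>\<^bsub>G\<^esub> = \<one>\<^bsub>G\<^esub>"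
    and f: "\<And>P. P \<in> S \<Longrightarrow> f P = \<one>\<^bsub>G\<^esub>"
  shows "finprod G f S = \<one>\<^bsub>G\<^esub>"
proof -
  have ex: "(S, \<one>\<^bsub>G\<^esub>) \<in> foldSetD (carrier G) (mult G \<circ> f) \<one>\<^bsub>G\<^esub>"
    using assms(1) f
  proof (induction S)
    case empty
    then show ?case using one by (auto intro: foldSetD.emptyI)
  next
    case (insert P S)
    then have "(insert P S, (mult G \<circ> f) P \<one>\<^bsub>G\<^esub>) \<in> foldSetD (carrier G) (mult G \<circ> f) \<one>\<^bsub>G\<^esub>"
      using one by (intro foldSetD.insertI) auto
    then show ?case using insert.prems one by (simp add: o_def)
  qed
  have "foldD (carrier G) (mult G \<circ> f) \<one>\<^bsub>G\<^esub> S = \<one>\<^bsub>G\<^esub>"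
    unfolding foldD_def
  proof (rule the_equality)
    show "(S, \<one>\<^bsub>G\<^esub>) \<in> foldSetD (carrier G) (mult G \<circ> f) \<one>\<^bsub>G\<^esub>" by (fact ex)
  next
    fix z assume "(S, z) \<in> foldSetD (carrier G) (mult G \<circ> f) \<one>\<^bsub>G\<^esub>"
    then show "z = \<one>\<^bsub>G\<^esub>" by (rule foldSetD_neutral) (use f one in auto)
  qed
  then show ?thesis using assms(1) by (simp add: finprod_def)
qed

text \<open>The constant exponent \<open>2\<close> is a nontrivial relation among the elements of any nonempty
  finite set.\<close>

lemma rank_zero_if_exponent_two:
  assumes "\<one>\<^bsub>G\<^esub> \<in> carrier G"
    and one: "\<And>P. P \<in> carrier G \<Longrightarrow> \<one>\<^bsub>G\<^esub> \<otimes>\<^bsub>G\<^esub> P = P"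
    and two: "\<And>P. P \<in> carrier G \<Longrightarrow> P \<otimes>\<^bsub>G\<^esub> P = \<one>\<^bsub>G\<^esub>"
  shows "abelian_group_rank G = 0"
proof -
  have "card S = 0" if S: "independent_in G S" for S
  proof -
    have fin: "finite S" "S \<subseteq> carrier G" using S by (auto simp: independent_in_def)
    have sq: "P [^]\<^bsub>G\<^esub> (2::int) = \<one>\<^bsub>G\<^esub>" if "P \<in> S" for P
      using that fin one two by (auto simp: int_pow_def numeral_2_eq_2)
    have "finprod G (\<lambda>P. P [^]\<^bsub>G\<^esub> (2::int)) S = \<one>\<^bsub>G\<^esub>"
      using fin sq assms by (intro finprod_neutral) auto
    then have "\<forall>P\<in>S. (2::int) = 0"
      using S unfolding independent_in_def by (elim conjE) (drule spec[of _ "\<lambda>_. 2"], simp)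
    then show ?thesis by auto
  qed
  then show ?thesis
    unfolding abelian_group_rank_def
    by (intro antisym SUP_least) (simp_all add: zero_enat_def[symmetric])
qed

section \<open>Translation by points of order two, duplication and halving\<close>

text \<open>A point of \<open>y^2 = x (x + a) (x + b)\<close> is its own negative exactly if \<open>y = 0\<close>, so this
  describes the \<open>x\<close>-coordinates of the rational points of order not dividing 2.\<close>

definition x_outside_2torsion :: "rat \<Rightarrow> rat \<Rightarrow> rat \<Rightarrow> bool" where
  "x_outside_2torsion a b x \<longleftrightarrow> (\<exists>y. y \<noteq> 0 \<and> y^2 = x * (x + a) * (x + b))"

text \<open>The duplication formula: the \<open>x\<close>-coordinate of \<open>2 P\<close> in terms of that of \<open>P\<close>.\<close>

definition double_x :: "rat \<Rightarrow> rat \<Rightarrow> rat \<Rightarrow> rat" where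
  "double_x a b x = (x^2 - a * b)^2 / (4 * (x * (x + a) * (x + b)))"

lemma x_outside_2torsion_nonzero:
  assumes "x_outside_2torsion a b x"
  shows "x \<noteq> 0" "x + a \<noteq> 0" "x + b \<noteq> 0"
  using assms by (auto simp: x_outside_2torsion_def)

lemma x_outside_2torsion_swap: "x_outside_2torsion a b x \<longleftrightarrow> x_outside_2torsion b a x"
  by (simp add: x_outside_2torsion_def mult_ac)

lemma double_x_swap: "double_x a b x = double_x b a x"
  by (simp add: double_x_def mult_ac)

text \<open>Translation by a point of order 2 multiplies the value of the cubic by a square \<open>c^2\<close>, and
  the square of \<open>x^2 - a b\<close> by the same \<open>c^2\<close>, so that the quotient defining
  \<open>double_x\<close> is unchanged.\<close>

lemma same_double:
  assumes "x_outside_2torsion a b x" "c \<noteq> 0"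
    and "x' * (x' + a) * (x' + b) = c^2 * (x * (x + a) * (x + b))"
    and "x'^2 - a * b = c * d" "d^2 = (x^2 - a * b)^2"
  shows "x_outside_2torsion a b x'" "double_x a b x' = double_x a b x"
proof -
  obtain y where y: "y \<noteq> 0" "y^2 = x * (x + a) * (x + b)"
    using assms(1) by (auto simp: x_outside_2torsion_def)
  then have "(c * y)^2 = x' * (x' + a) * (x' + b)" "c * y \<noteq> 0"
    using assms(2,3) by (auto simp: power_mult_distrib)
  then show "x_outside_2torsion a b x'"
    unfolding x_outside_2torsion_def by blast
  show "double_x a b x' = double_x a b x"
    unfolding double_x_def assms(3,4) power_mult_distrib assms(5)
    using assms(2) by simp
qed

text \<open>Adding the point \<open>(0, 0)\<close> sends \<open>x\<close> to \<open>a b / x\<close>, which has the square class of \<open>a b x\<close>.\<close>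

lemma translate_origin:
  assumes "x_outside_2torsion a b x" "a \<noteq> 0" "b \<noteq> 0"
  shows "x_outside_2torsion a b (a * b / x)" "double_x a b (a * b / x) = double_x a b x"
proof -
  note nz = x_outside_2torsion_nonzero[OF assms(1)]
  have 1: "a * b / x^2 \<noteq> 0" using nz assms by simp
  have 2: "a * b / x * (a * b / x + a) * (a * b / x + b) = (a * b / x^2)^2 * (x * (x + a) * (x + b))"
    using nz by (simp add: field_simps power2_eq_square)
  have 3: "(a * b / x)^2 - a * b = a * b / x^2 * (a * b - x^2)"
    using nz by (simp add: field_simps power2_eq_square)
  have 4: "(a * b - x^2)^2 = (x^2 - a * b)^2" by (rule power2_commute)
  show "x_outside_2torsion a b (a * b / x)" "double_x a b (a * b / x) = double_x a b x"
    by (fact same_double[OF assms(1) 1 2 3 4])+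
qed

text \<open>Adding the point \<open>(- a, 0)\<close> sends \<open>x\<close> to \<open>- a (x + b) / (x + a)\<close>. Since
  \<open>x (x + a) (x + b)\<close> is a square, this has the square class of \<open>- a x\<close>. The
  translation by \<open>(- b, 0)\<close> is the same statement with \<open>a\<close> and \<open>b\<close> exchanged.\<close>

lemma translate_a:
  assumes "x_outside_2torsion a b x" "a \<noteq> 0" "a \<noteq> b"
  shows "x_outside_2torsion a b (- a * (x + b) / (x + a))"
    "double_x a b (- a * (x + b) / (x + a)) = double_x a b x"
    "\<exists>q. - a * (x + b) / (x + a) = - a * x * q^2"
proof -
  note nz = x_outside_2torsion_nonzero[OF assms(1)]
  define w where "w = x + a"
  have x: "x = w - a" by (simp add: w_def)
  have w0: "w \<noteq> 0" using nz by (simp add: w_def)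
  let ?c = "a * (a - b) / (x + a)^2"
  have 1: "?c \<noteq> 0" using nz assms by simp
  have s1: "- a * (x + b) / (x + a) + a = a * (a - b) / (x + a)"
    and s2: "- a * (x + b) / (x + a) + b = (b - a) * x / (x + a)"
    using nz by (simp_all add: field_simps)
  have prod_eq: "- a * v / w * (a * (a - b) / w) * ((b - a) * x / w) = (a * (a - b) / w^2)^2 * (x * w * v)"
    if "w \<noteq> 0" for v w :: rat
    using that by (simp add: field_simps power2_eq_square)
  have 2: "- a * (x + b) / (x + a) * (- a * (x + b) / (x + a) + a) * (- a * (x + b) / (x + a) + b)
     = ?c^2 * (x * (x + a) * (x + b))"
    unfolding s1 s2 by (rule prod_eq) (use nz in simp)
  have 3: "(- a * (x + b) / (x + a))^2 - a * b = ?c * (x^2 - a * b)"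
    using w0 unfolding x by (simp add: field_simps power2_eq_square)
  show "x_outside_2torsion a b (- a * (x + b) / (x + a))"
    "double_x a b (- a * (x + b) / (x + a)) = double_x a b x"
    by (fact same_double[OF assms(1) 1 2 3 refl])+
  obtain y where y: "y^2 = x * (x + a) * (x + b)"
    using assms(1) by (auto simp: x_outside_2torsion_def)
  have "- a * x * (x * w * v / (x * w)^2) = - a * v / w" if "w \<noteq> 0" for v w :: rat
    using that nz(1) by (simp add: field_simps power2_eq_square)
  then have "- a * x * (y / (x * (x + a)))^2 = - a * (x + b) / (x + a)"
    unfolding power_divide y using nz(2) by blast
  then show "\<exists>q. - a * (x + b) / (x + a) = - a * x * q^2" by metis
qed

text \<open>A point is a double as soon as \<open>x\<close>, \<open>x + a\<close> and \<open>x + b\<close> are all squares. The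
  \<open>x\<close>-coordinate of a half is explicit: with \<open>a = \<beta>^2 - \<alpha>^2\<close> and \<open>b = \<gamma>^2 - \<alpha>^2\<close>, the three
  factors of the cubic at \<open>X = (\<alpha> + \<beta>) (\<alpha> + \<gamma>)\<close> are the pairwise products of \<open>\<alpha> + \<beta>\<close>, \<open>\<alpha> + \<gamma>\<close>
  and \<open>\<beta> + \<gamma>\<close>, and \<open>X^2 - a b\<close> is \<open>2 \<alpha>\<close> times the product of all three.\<close>

lemma halving:
  assumes "a \<noteq> 0" "b \<noteq> 0" "a \<noteq> b"
    and x: "x = \<alpha>^2" and xa: "x + a = \<beta>^2" and xb: "x + b = \<gamma>^2"
  shows "x_outside_2torsion a b ((\<alpha> + \<beta>) * (\<alpha> + \<gamma>))" "double_x a b ((\<alpha> + \<beta>) * (\<alpha> + \<gamma>)) = x"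
proof -
  have a: "a = \<beta>^2 - \<alpha>^2" and b: "b = \<gamma>^2 - \<alpha>^2" using x xa xb by simp_all
  have nz: "\<alpha> + \<beta> \<noteq> 0" "\<alpha> + \<gamma> \<noteq> 0" "\<beta> + \<gamma> \<noteq> 0"
    using assms(1-3) unfolding a b by (auto simp: power2_eq_square eq_neg_iff_add_eq_0[symmetric])
  let ?X = "(\<alpha> + \<beta>) * (\<alpha> + \<gamma>)"
  let ?Y = "(\<alpha> + \<beta>) * (\<alpha> + \<gamma>) * (\<beta> + \<gamma>)"
  have Y: "?X * (?X + a) * (?X + b) = ?Y^2"
    unfolding a b by (simp add: algebra_simps power2_eq_square)
  show "x_outside_2torsion a b ?X"
    unfolding x_outside_2torsion_def Y using nz by (intro exI[of _ ?Y]) auto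
  have "?X^2 - a * b = 2 * \<alpha> * ?Y"
    unfolding a b by (simp add: algebra_simps power2_eq_square)
  then show "double_x a b ?X = x"
    unfolding double_x_def Y using nz x by (simp add: power_mult_distrib)
qed

section \<open>From rational to integral equations\<close>

lemma rat_square_int:
  fixes q :: rat and N :: int
  assumes "q^2 = of_int N"
  obtains n where "q = of_int n"
proof -
  obtain p k where pk: "quotient_of q = (p, k)" by fastforce
  have k: "k > 0" "coprime p k" "q = of_int p / of_int k"
    using quotient_of_denom_pos[OF pk] quotient_of_coprime[OF pk] quotient_of_div[OF pk] by auto
  have "(of_int (p^2) :: rat) = of_int (N * k^2)"
    using assms k by (simp add: field_simps power_divide)
  then have "p^2 = N * k^2" by (simp only: of_int_eq_iff)
  then have "k^2 dvd p^2" by simp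
  then have "k dvd p" by simp
  with k have "k = 1" by (metis coprime_common_divisor dvd_refl zdvd1_eq abs_of_pos)
  with k that show ?thesis by simp
qed

lemma coprime_mult_square_int:
  fixes N k n :: int
  assumes "coprime N k" "N * k = n^2" "N > 0" "k > 0"
  obtains u v where "N = u^2" "k = v^2" "v > 0"
proof -
  have "coprime (nat N) (nat k)" using assms by (simp add: coprime_int_iff[symmetric])
  moreover have "nat N * nat k = (nat \<bar>n\<bar>)^2"
    using assms by (metis nat_mult_distrib nat_power_eq abs_ge_zero power2_abs less_imp_le)
  ultimately have "is_square (nat N)" "is_square (nat k)"
    using assms is_nth_power_mult_coprime_natD[of "nat N" "nat k" 2] by (auto intro: is_nth_powerI)
  then obtain u v where "nat N = u^2" "nat k = v^2" by (auto elim!: is_nth_powerE)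
  then have "N = (int u)^2" "k = (int v)^2" using assms by (auto simp: nat_eq_iff)
  moreover from this have "int v > 0" using assms by (metis of_nat_0_less_iff of_nat_0 gr0I power_zero_numeral less_irrefl)
  ultimately show ?thesis using that by blast
qed

text \<open>If \<open>x = m / k\<close> in lowest terms, then \<open>m (m + a k) (m + b k)\<close> is coprime to \<open>k\<close>, and its
  product with \<open>k\<close> is the square of \<open>y k^2\<close>; hence both are squares.\<close>

lemma x_outside_2torsion_integral:
  fixes a b :: int
  assumes "x_outside_2torsion (of_int a) (of_int b) x"
  obtains m e n :: int where "e > 0" "coprime m e" "x = of_int m / of_int (e^2)"
    "n \<noteq> 0" "n^2 = m * (m + a * e^2) * (m + b * e^2)"
proof -
  obtain y where y: "y \<noteq> 0" "y^2 = x * (x + of_int a) * (x + of_int b)"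
    using assms by (auto simp: x_outside_2torsion_def)
  obtain m k where mk: "quotient_of x = (m, k)" by fastforce
  have k: "k > 0" "coprime m k" "x = of_int m / of_int k"
    using quotient_of_denom_pos[OF mk] quotient_of_coprime[OF mk] quotient_of_div[OF mk] by auto
  define N where "N = m * (m + a * k) * (m + b * k)"
  have "(y * of_int (k^2))^2 = of_int (N * k)"
    unfolding power_mult_distrib y(2) N_def k(3) using k(1)
    by (simp add: field_simps power2_eq_square)
  then obtain n0 where n0: "y * of_int (k^2) = of_int n0" by (rule rat_square_int)
  have "(of_int (N * k) :: rat) = of_int (n0^2)"
    using \<open>(y * of_int (k^2))^2 = of_int (N * k)\<close> n0 by simp
  then have sq: "N * k = n0^2" by (simp only: of_int_eq_iff)
  have "n0 \<noteq> 0" using n0 y(1) k(1) by auto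
  then have "N * k > 0" using sq by simp
  then have "N > 0" using k(1) by (simp add: zero_less_mult_iff)
  have "coprime (m + a * k) k" "coprime (m + b * k) k"
    using k(2) by (simp_all add: coprime_iff_gcd_eq_1 gcd.commute[of _ k] gcd_add_mult add.commute[of m])
  then have "coprime N k" using k(2) by (simp add: N_def)
  then obtain u e where ue: "N = u^2" "k = e^2" "e > 0"
    using coprime_mult_square_int sq \<open>N > 0\<close> k(1) by metis
  show ?thesis
  proof (rule that)
    show "e > 0" by (fact ue)
    show "coprime m e" using k(2) ue by simp
    show "x = of_int m / of_int (e^2)" using k(3) ue by simp
    show "u \<noteq> 0" using \<open>N > 0\<close> ue by auto
    show "u^2 = m * (m + a * e^2) * (m + b * e^2)" using ue by (simp add: N_def)
  qed
qed

section \<open>The square class of the x-coordinate\<close>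

text \<open>Applied once for each prime of a given set, this lists the squarefree integers all of whose
  prime divisors lie in the set.\<close>

lemma squarefree_strip_prime:
  fixes s p :: int
  assumes "squarefree s" "prime \<bar>p\<bar>"
  obtains t c where "s = c * t" "c = 1 \<or> c = p" "squarefree t"
    "\<And>q. prime q \<Longrightarrow> q dvd t \<Longrightarrow> q dvd s \<and> \<not> q dvd p"
proof (cases "p dvd s")
  case True
  then obtain t where t: "s = p * t" by blast
  have "\<not> q dvd p" if q: "prime q" "q dvd t" for q
  proof
    assume "q dvd p"
    then have "q * q dvd s" using t q by (simp add: mult_dvd_mono)
    then show False using assms(1) q by (auto simp: squarefree_def power2_eq_square)
  qed
  then show ?thesis
    using that[of p t] t assms(1) squarefree_multD[of p t] by auto
next
  case False
  have "\<not> q dvd p" if q: "prime q" "q dvd s" for q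
  proof
    assume "q dvd p"
    then have "q = \<bar>p\<bar>" using assms(2) q by (metis dvd_abs_iff primes_dvd_imp_eq)
    then show False using False q by simp
  qed
  then show ?thesis using that[of 1 s] assms(1) by auto
qed

lemma squarefree_no_prime_divisor:
  fixes s :: int
  assumes "squarefree s" "\<And>q. prime q \<Longrightarrow> \<not> q dvd s"
  shows "s = 1 \<or> s = -1"
proof -
  have "s \<noteq> 0" using assms(1) by auto
  then have "is_unit s" using assms(2) prime_divisor_exists[of s] by blast
  then show ?thesis by auto
qed

text \<open>The prime \<open>q\<close> divides \<open>s z^2\<close> to an odd power, so it must divide the other factor \<open>W\<close> of
  the square \<open>n^2\<close>.\<close>

lemma prime_dvd_cofactor_of_squarefree:
  fixes s z W n :: int
  assumes "squarefree s" "z \<noteq> 0" "n^2 = s * z^2 * W" "prime q" "q dvd s"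
  shows "q dvd W"
proof -
  have "z^2 dvd n^2" using assms(3) by (metis dvd_triv_left mult.assoc mult.commute)
  then have "z dvd n" by simp
  then obtain k where k: "n = z * k" by blast
  then have eq: "k^2 = s * W" using assms(2,3) by (simp add: power_mult_distrib algebra_simps)
  then have "q dvd k^2" using assms(5) by simp
  then have "q dvd k" using assms(4) by (simp add: prime_dvd_power_iff)
  then have "q^2 dvd s * W" using eq by (metis dvd_power_same)
  show ?thesis
  proof (rule ccontr)
    assume "\<not> q dvd W"
    then have "coprime q W" using assms(4) by (simp add: prime_imp_coprime)
    then have "coprime (q^2) W" by simp
    then have "q^2 dvd s" using \<open>q^2 dvd s * W\<close> by (simp add: coprime_dvd_mult_left_iff)
    then show False using assms(1,4) by (auto simp: squarefree_def)
  qed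
qed

text \<open>A prime \<open>q\<close> in the squarefree part of \<open>m\<close> divides one of the other two factors, hence
  \<open>A r e^2\<close> or \<open>B r e^2\<close>, and it does not divide \<open>e\<close>. So only \<open>\<bar>A\<bar>\<close>, \<open>\<bar>B\<bar>\<close> and \<open>\<bar>r\<bar>\<close> can
  occur.\<close>

lemma square_class_candidates:
  fixes A B r m e n :: int
  assumes primes: "prime \<bar>A\<bar>" "prime \<bar>B\<bar>" "prime \<bar>r\<bar>" and "coprime m e" "n \<noteq> 0"
    and n: "n^2 = m * (m + A * r * e^2) * (m + B * r * e^2)"
  obtains u \<alpha> \<beta> \<rho> z where "u = 1 \<or> u = -1" "\<alpha> = 1 \<or> \<alpha> = A" "\<beta> = 1 \<or> \<beta> = B" "\<rho> = 1 \<or> \<rho> = r"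
    "m = u * \<alpha> * \<beta> * \<rho> * z^2"
proof -
  define s z where "s = squarefree_part m" and "z = square_part m"
  have m: "m = s * z^2" unfolding s_def z_def by (rule squarefree_decompose)
  have s: "squarefree s" by (simp add: s_def)
  have "z \<noteq> 0" using n \<open>n \<noteq> 0\<close> m by auto
  have sdvd: "q dvd A \<or> q dvd B \<or> q dvd r" if q: "prime q" "q dvd s" for q
  proof -
    have "q dvd (m + A * r * e^2) * (m + B * r * e^2)"
      using s \<open>z \<noteq> 0\<close> _ q by (rule prime_dvd_cofactor_of_squarefree) (use n m in \<open>simp add: mult_ac\<close>)
    then have "q dvd m + A * r * e^2 \<or> q dvd m + B * r * e^2"
      using q by (simp add: prime_dvd_mult_iff)
    moreover have "q dvd m" using q m by simp
    ultimately have "q dvd A * r * e^2 \<or> q dvd B * r * e^2"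
      using dvd_add_right_iff by blast
    moreover have "\<not> q dvd e"
      using \<open>coprime m e\<close> \<open>q dvd m\<close> q by (meson coprime_common_divisor not_prime_unit)
    ultimately show ?thesis using q by (auto simp: prime_dvd_mult_iff prime_dvd_power_iff)
  qed
  obtain s1 \<alpha> where s1: "s = \<alpha> * s1" "\<alpha> = 1 \<or> \<alpha> = A" "squarefree s1"
      "\<And>q. prime q \<Longrightarrow> q dvd s1 \<Longrightarrow> q dvd s \<and> \<not> q dvd A"
    using squarefree_strip_prime[OF s primes(1)] by metis
  obtain s2 \<beta> where s2: "s1 = \<beta> * s2" "\<beta> = 1 \<or> \<beta> = B" "squarefree s2"
      "\<And>q. prime q \<Longrightarrow> q dvd s2 \<Longrightarrow> q dvd s1 \<and> \<not> q dvd B"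
    using squarefree_strip_prime[OF s1(3) primes(2)] by metis
  obtain u \<rho> where u: "s2 = \<rho> * u" "\<rho> = 1 \<or> \<rho> = r" "squarefree u"
      "\<And>q. prime q \<Longrightarrow> q dvd u \<Longrightarrow> q dvd s2 \<and> \<not> q dvd r"
    using squarefree_strip_prime[OF s2(3) primes(3)] by metis
  have "u = 1 \<or> u = -1"
    using u(3) by (rule squarefree_no_prime_divisor) (meson u(4) s2(4) s1(4) sdvd)
  moreover have "m = u * \<alpha> * \<beta> * \<rho> * z^2" by (simp add: m s1 s2 u)
  ultimately show ?thesis using that s1(2) s2(2) u(2) by blast
qed

text \<open>The four classes \<open>1\<close>, \<open>A B\<close>, \<open>- A r\<close>, \<open>- B r\<close> of the points of order dividing 2 are used to
  remove \<open>B\<close> and \<open>r\<close> from the square class of \<open>x\<close>. The representatives \<open>1, -1, A, -A\<close> are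
  chosen because each of the three nontrivial ones is then excluded at a single prime.\<close>

lemma translate_square_class:
  fixes A B r :: int
  assumes primes: "prime \<bar>A\<bar>" "prime \<bar>B\<bar>" "prime \<bar>r\<bar>" and "A \<noteq> B"
    and x: "x_outside_2torsion (of_int (A * r)) (of_int (B * r)) x"
  obtains x' q d where "x_outside_2torsion (of_int (A * r)) (of_int (B * r)) x'"
    "double_x (of_int (A * r)) (of_int (B * r)) x' = double_x (of_int (A * r)) (of_int (B * r)) x"
    "x' = of_int d * q^2" "d \<in> {1, -1, A, -A}"
proof -
  define a b :: rat where "a = of_int (A * r)" and "b = of_int (B * r)"
  have nz: "A \<noteq> 0" "B \<noteq> 0" "r \<noteq> 0" using primes by auto
  then have ab: "a \<noteq> 0" "b \<noteq> 0" "a \<noteq> b" using \<open>A \<noteq> B\<close> by (auto simp: a_def b_def)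
  have x: "x_outside_2torsion a b x" using x by (simp only: a_def b_def)
  obtain m e n where e: "e > 0" "coprime m e" "x = of_int m / of_int (e^2)" "n \<noteq> 0"
      "n^2 = m * (m + A * r * e^2) * (m + B * r * e^2)"
    using assms(5) by (rule x_outside_2torsion_integral)
  obtain u \<alpha> \<beta> \<rho> z where u: "u = 1 \<or> u = -1" "\<alpha> = 1 \<or> \<alpha> = A" "\<beta> = 1 \<or> \<beta> = B" "\<rho> = 1 \<or> \<rho> = r"
      and m: "m = u * \<alpha> * \<beta> * \<rho> * z^2"
    using square_class_candidates[OF primes e(2,4,5)] by metis
  define q :: rat where "q = of_int z / of_int e"
  have xq: "x = of_int (u * \<alpha> * \<beta> * \<rho>) * q^2"
    using e(1,3) m by (simp add: q_def power_divide)
  then have q: "q \<noteq> 0" using x_outside_2torsion_nonzero(1)[OF x] by auto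
  \<comment> \<open>The translation is by the point at infinity, \<open>(0, 0)\<close>, \<open>(- a, 0)\<close> or \<open>(- b, 0)\<close>, depending on
    which of \<open>B\<close> and \<open>r\<close> occur in the class.\<close>
  have "\<exists>x' d q'. x_outside_2torsion a b x' \<and> double_x a b x' = double_x a b x \<and>
      x' = of_int d * q'^2 \<and> d \<in> {u * \<alpha>, u * \<alpha> * A, - u * \<alpha>, - u * \<alpha> * A}"
    using u(3,4)
  proof (elim disjE)
    assume "\<beta> = 1" "\<rho> = 1"
    then show ?thesis using x xq by (intro exI[of _ x] exI[of _ "u * \<alpha>"] exI[of _ q]) auto
  next
    assume "\<beta> = B" "\<rho> = 1"
    then have "a * b / x = of_int (u * \<alpha> * A) * (of_int (r * \<alpha>) / (q * of_int \<alpha>^2))^2"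
      using u(1,2) nz q unfolding xq a_def b_def by (auto simp: field_simps power2_eq_square)
    then show ?thesis using translate_origin[OF x ab(1,2)] by blast
  next
    assume h: "\<beta> = 1" "\<rho> = r"
    obtain q' where "- a * (x + b) / (x + a) = - a * x * q'^2"
      using translate_a(3)[OF x ab(1,3)] by blast
    also have "\<dots> = of_int (- u * \<alpha> * A) * (of_int r * q * q')^2"
      unfolding xq a_def using h by (simp add: power2_eq_square)
    finally show ?thesis using translate_a(1,2)[OF x ab(1,3)] by blast
  next
    assume h: "\<beta> = B" "\<rho> = r"
    have x': "x_outside_2torsion b a x" using x x_outside_2torsion_swap by blast
    note t = translate_a[OF x' ab(2) ab(3)[symmetric]]
    obtain q' where "- b * (x + a) / (x + b) = - b * x * q'^2" using t(3) by blast
    also have "\<dots> = of_int (- u * \<alpha>) * (of_int (B * r) * q * q')^2"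
      unfolding xq b_def using h by (simp add: power2_eq_square)
    finally show ?thesis
      using t(1,2) unfolding x_outside_2torsion_swap[of b a] double_x_swap[of b a] by blast
  qed
  then obtain x' d q' where x': "x_outside_2torsion a b x'" "double_x a b x' = double_x a b x"
      "x' = of_int d * q'^2" and d: "d \<in> {u * \<alpha>, u * \<alpha> * A, - u * \<alpha>, - u * \<alpha> * A}" by blast
  \<comment> \<open>The translation may have introduced a second factor \<open>A\<close>, which is absorbed in the square.\<close>
  have "d \<in> {1, -1, A, -A} \<or> d = A^2 \<or> d = - (A^2)"
    using d u(1,2) by (auto simp: power2_eq_square)
  then obtain d' c where "d = d' * c^2" "d' \<in> {1, -1, A, -A}"
    by (elim disjE) (rule that[of d 1] that[of 1 A] that[of "-1" A]; simp)+
  then have "x' = of_int d' * (of_int c * q')^2" using x'(3) by (simp add: power_mult_distrib)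
  then show ?thesis
    using that x'(1,2) \<open>d' \<in> _\<close> unfolding a_def b_def by blast
qed

section \<open>Quadratic residues and squares modulo powers of two\<close>

text \<open>Gauss's lemma for the multiplier \<open>2\<close>: if \<open>r = 8 k + 7\<close>, the doubles \<open>2 x\<close> with \<open>x \<le> 4 k + 3\<close>
  that exceed \<open>4 k + 3\<close> are those with \<open>x \<ge> 2 k + 2\<close>, an even number of them.\<close>

lemma QuadRes_two_of_7_mod_8:
  fixes r :: int
  assumes "prime r" "[r = 7] (mod 8)"
  shows "QuadRes r 2"
proof -
  define p where "p = nat r"
  have r: "r = int p" using assms(1) by (simp add: p_def prime_gt_0_int less_imp_le)
  have p: "prime p" using assms(1) r by simp
  have "r mod 8 = 7" using assms(2) by (simp add: cong_def)
  then obtain k where k: "r = 8 * k + 7" "k \<ge> 0"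
    using r by (metis div_mult_mod_eq mult.commute of_nat_0_le_iff pos_imp_zdiv_nonneg_iff zero_less_numeral)
  have "\<not> int p dvd 2" using k r zdvd_imp_le[of "int p" 2] by linarith
  moreover have "2 < p" using k r by linarith
  ultimately interpret GAUSS p 2
    by unfold_locales (use p in \<open>simp_all add: cong_0_iff\<close>)
  have half: "(int p - 1) div 2 = 4 * k + 3" using k r by simp
  have "E = (\<lambda>x. 2 * x) ` {2 * k + 2..4 * k + 3}"
  proof (intro equalityI subsetI)
    fix y assume "y \<in> E"
    then obtain x where x: "0 < x" "x \<le> 4 * k + 3" "y = (x * 2) mod int p" "4 * k + 3 < y"
      unfolding E_def C_def B_def A_def half by auto
    then have "y = x * 2" using k r by simp
    then show "y \<in> (\<lambda>x. 2 * x) ` {2 * k + 2..4 * k + 3}" using x by auto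
  next
    fix y assume "y \<in> (\<lambda>x. 2 * x) ` {2 * k + 2..4 * k + 3}"
    then obtain x where x: "2 * k + 2 \<le> x" "x \<le> 4 * k + 3" "y = 2 * x" by auto
    then have "y = (x * 2) mod int p" using k r by simp
    then show "y \<in> E" unfolding E_def C_def B_def A_def half using x k by auto
  qed
  then have "card E = nat (2 * k + 2)"
    by (simp add: card_image inj_on_def)
  then have "even (card E)" by (simp add: even_nat_iff k)
  then have "Legendre 2 r = 1" using gauss_lemma r by simp
  then show ?thesis by (simp add: Legendre_def split: if_splits)
qed

lemma QuadRes_cancel:
  fixes p c d k :: int
  assumes "prime p" "\<not> p dvd c" "[k^2 = d * c^2] (mod p)"
  shows "QuadRes p d"
proof -
  have "coprime c p" using prime_imp_coprime[OF assms(1,2)] by (simp add: coprime_commute)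
  then obtain i where i: "[c * i = 1] (mod p)" by (metis cong_solve_coprime_int)
  have "[(k * i)^2 = d * (c * i)^2] (mod p)"
    using cong_mult[OF assms(3) cong_refl[of "i^2"]] by (simp add: power_mult_distrib mult_ac)
  also have "[d * (c * i)^2 = d * 1^2] (mod p)" by (intro cong_mult cong_pow i cong_refl)
  finally show ?thesis unfolding QuadRes_def by auto
qed

lemma Legendre_neg_one_iff:
  "Legendre d p = -1 \<longleftrightarrow> \<not> p dvd d \<and> \<not> QuadRes p d"
  by (auto simp: Legendre_def cong_0_iff)

lemma cong_int_lin: "[n = c] (mod m) \<Longrightarrow> \<exists>i. n = c + m * i" for n c m :: int
  using cong_iff_lin cong_sym by blast

lemma square_mod_16: "(k::int)^2 mod 16 \<in> {0, 1, 4, 9}"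
proof -
  have "k mod 16 \<in> {0, 1, 2, 3, 4, 5, 6, 7, 8, 9, 10, 11, 12, 13, 14, 15}"
    unfolding insert_iff empty_iff by presburger
  moreover have "k^2 mod 16 = (k mod 16)^2 mod 16" by (simp add: power_mod)
  ultimately show ?thesis by auto
qed

lemma odd_square_cong_8:
  assumes "odd (k::int)"
  shows "[k^2 = 1] (mod 8)"
proof -
  obtain j where j: "k = 2 * j + 1" using assms by (elim oddE)
  have "even (j * (j + 1))" by simp
  then obtain i where "j * (j + 1) = 2 * i" by (elim evenE)
  then have "k^2 - 1 = 8 * i" by (simp add: j power2_eq_square algebra_simps)
  then show ?thesis by (simp add: cong_iff_dvd_diff)
qed

section \<open>Local obstructions\<close>

text \<open>The right-hand side is not a square of a 2-adic number. If \<open>z\<close> and \<open>e\<close> are odd, its three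
  factors are an odd number, an odd multiple of \<open>2\<close> and an odd multiple of \<open>4\<close>, so its 2-adic
  valuation is \<open>3\<close>. If only \<open>z\<close> is odd, it is congruent to \<open>d^3\<close> and thus to \<open>3\<close> modulo \<open>4\<close>.
  If only \<open>e\<close> is odd, it is congruent to \<open>5\<close> modulo \<open>8\<close>.\<close>

lemma two_adic_obstruction:
  fixes a b d z e k :: int
  assumes a: "[a = 7] (mod 8)" and b: "[b = 5] (mod 8)" and d: "[d = 7] (mod 8)"
    and "coprime z e"
    and k: "k^2 = d * (d * z^2 + a * e^2) * (d * z^2 + b * e^2)"
  shows False
proof -
  have k16: "k^2 mod 16 \<in> {0, 1, 4, 9}" by (rule square_mod_16)
  have "k^2 mod 8 = k^2 mod 16 mod 8" by (simp add: mod_mod_cancel)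
  then have k8: "k^2 mod 8 \<in> {0, 1, 4}" using k16 by auto
  consider "odd z" "odd e" | "odd z" "even e" | "even z" "odd e"
    using \<open>coprime z e\<close> coprime_common_divisor[of z e 2] by auto
  then show False
  proof cases
    case 1
    have "[d * z^2 + a * e^2 = 7 * 1 + 7 * 1] (mod 8)" "[d * z^2 + b * e^2 = 7 * 1 + 5 * 1] (mod 8)"
      by (intro cong_add cong_mult a b d odd_square_cong_8 1)+
    then obtain X Y D where "d * z^2 + a * e^2 = 14 + 8 * X" "d * z^2 + b * e^2 = 12 + 8 * Y" "d = 7 + 8 * D"
      using cong_int_lin[OF d] by (auto dest!: cong_int_lin)
    then have "k^2 = (7 + 8 * D) * (14 + 8 * X) * (12 + 8 * Y)" using k by simp
    also have "\<dots> = 8 + 16 * (7 * (10 + 7 * Y + 6 * X + 4 * X * Y) + 3 + D * (14 + 8 * X) * (6 + 4 * Y))"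
      by (simp add: algebra_simps)
    finally obtain W where "k^2 = 8 + 16 * W" by blast
    then show False using k16 by auto
  next
    case 2
    have e4: "[e^2 = 0] (mod 4)" using 2 by (auto simp: cong_0_iff power_mult_distrib elim!: evenE)
    have "4 dvd (8::int)" by simp
    then have m4: "[a = 7] (mod 4)" "[b = 5] (mod 4)" "[d = 7] (mod 4)" "[z^2 = 1] (mod 4)"
      using a b d odd_square_cong_8[OF 2(1)] by (blast intro: cong_dvd_modulus)+
    have "[k^2 = 7 * (7 * 1 + 7 * 0) * (7 * 1 + 5 * 0)] (mod 4)"
      unfolding k by (intro cong_add cong_mult m4 e4)
    then have "k^2 mod 4 = 3" by (simp add: cong_def)
    moreover have "k^2 mod 4 = k^2 mod 16 mod 4" by (simp add: mod_mod_cancel)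
    ultimately show False using k16 by auto
  next
    case 3
    then obtain t where t: "z = 2 * t" by (elim evenE)
    have "[k^2 = 7 * (7 * z^2 + 7 * 1) * (7 * z^2 + 5 * 1)] (mod 8)"
      unfolding k by (intro cong_add cong_mult a b d odd_square_cong_8 3 cong_refl)
    also have "7 * (7 * z^2 + 7 * 1) * (7 * z^2 + 5 * 1) = 8 * (7 * (98 * t^4 + 42 * t^2 + 4) + 2) + 5"
      unfolding t by (simp add: algebra_simps power2_eq_square eval_nat_numeral)
    also have "[\<dots> = 5] (mod 8)" by (simp add: cong_iff_dvd_diff)
    finally have "k^2 mod 8 = 5" by (simp add: cong_def)
    then show False using k8 by auto
  qed
qed

text \<open>If \<open>r\<close> does not divide \<open>z\<close>, then modulo \<open>r\<close> the equation says that \<open>A\<close> times a nonzero square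
  is a square. If \<open>r\<close> divides \<open>z\<close>, then \<open>r^2\<close> can be divided out, and modulo \<open>r\<close> it says
  the same of \<open>B\<close>.\<close>

lemma r_adic_obstruction:
  fixes A B r z e k :: int
  assumes "prime r" "Legendre A r = -1" "Legendre B r = -1" "coprime z e"
    and k: "k^2 = A * (A * z^2 + A * r * e^2) * (A * z^2 + B * r * e^2)"
  shows False
proof -
  have rA: "\<not> r dvd A" "\<not> QuadRes r A" and rB: "\<not> QuadRes r B"
    using assms(2,3) by (simp_all add: Legendre_neg_one_iff)
  show False
  proof (cases "r dvd z")
    case False
    have "[k^2 = A * (A * z^2)^2] (mod r)"
      unfolding cong_iff_dvd_diff k
      by (rule dvdI[of _ _ "A * (A * z^2 * (A * e^2 + B * e^2) + A * B * r * e^4)"])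
        (simp add: algebra_simps power2_eq_square eval_nat_numeral)
    moreover have "\<not> r dvd A * z^2"
      using False rA(1) assms(1) by (simp add: prime_dvd_mult_iff prime_dvd_power_iff)
    ultimately show False using QuadRes_cancel[OF assms(1)] rA(2) by blast
  next
    case True
    then obtain t where t: "z = r * t" by blast
    have eq: "k^2 = r^2 * (A * (A * r * t^2 + A * e^2) * (A * r * t^2 + B * e^2))"
      unfolding k t by (simp add: algebra_simps power2_eq_square)
    then have "r^2 dvd k^2" by simp
    then have "r dvd k" by simp
    then obtain l where l: "k = r * l" by blast
    then have l2: "l^2 = A * (A * r * t^2 + A * e^2) * (A * r * t^2 + B * e^2)"
      using eq assms(1) by (auto simp: power_mult_distrib)
    have "[l^2 = B * (A * e^2)^2] (mod r)"
      unfolding cong_iff_dvd_diff l2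
      by (rule dvdI[of _ _ "A * (A * t^2 * (A * e^2 + B * e^2) + A * A * r * t^4)"])
        (simp add: algebra_simps power2_eq_square eval_nat_numeral)
    moreover have "\<not> r dvd A * e^2"
      using True rA(1) assms(1,4)
      by (auto simp: prime_dvd_mult_iff prime_dvd_power_iff dest: coprime_common_divisor not_prime_unit)
    ultimately show False using QuadRes_cancel[OF assms(1)] rB by blast
  qed
qed

text \<open>Let \<open>s\<close> be the squarefree part of the first factor; its primes also divide the second factor.
  An odd prime \<open>q \<noteq> r\<close> dividing \<open>s\<close> divides \<open>A - B\<close>, and \<open>z^2 \<equiv> - B r e^2\<close> modulo \<open>q\<close> contradicts
  the hypothesis on \<open>A - B\<close>. So \<open>s\<close> is, up to sign, one of \<open>1, 2, r, 2 r\<close>. A negative \<open>s\<close> would make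
  both factors negative, which the signs of \<open>A\<close> and \<open>B\<close> forbid. If \<open>r\<close> divides \<open>s\<close>, division by
  \<open>r\<close> shows that \<open>A\<close> is a residue modulo \<open>r\<close>, because \<open>2\<close> is one. If \<open>s = 2\<close>, then \<open>z\<close> and \<open>e\<close>
  are odd, the second factor is \<open>6\<close> modulo \<open>8\<close>, and twice such a number is not a square.\<close>

lemma trivial_square_class:
  fixes A B r z e k :: int
  assumes "prime r" and a: "[A * r = 7] (mod 8)" and b: "[B * r = 5] (mod 8)" and r: "[r = 7] (mod 8)"
    and A: "Legendre A r = -1"
    and D: "\<And>p. prime p \<Longrightarrow> odd p \<Longrightarrow> p dvd A - B \<Longrightarrow> Legendre (- B * r) p = -1"
    and sgn: "A > 0 \<or> B > 0"
    and "coprime z e" "k \<noteq> 0"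
    and k: "k^2 = (z^2 + A * r * e^2) * (z^2 + B * r * e^2)"
  shows "is_square (z^2 + A * r * e^2)" "is_square (z^2 + B * r * e^2)"
proof -
  let ?U = "z^2 + A * r * e^2" and ?V = "z^2 + B * r * e^2"
  define s u where "s = squarefree_part ?U" and "u = square_part ?U"
  have U: "?U = s * u^2" unfolding s_def u_def by (rule squarefree_decompose)
  have s: "squarefree s" by (simp add: s_def)
  have "u \<noteq> 0" using k U \<open>k \<noteq> 0\<close> by auto
  have ndvd: "\<not> (q dvd z \<and> q dvd e)" if "prime q" for q
    using that \<open>coprime z e\<close> coprime_common_divisor not_prime_unit by blast
  have sdvd: "q dvd 2 \<or> q dvd r" if q: "prime q" "q dvd s" for q
  proof (rule ccontr)
    assume "\<not> (q dvd 2 \<or> q dvd r)"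
    then have q': "\<not> q dvd r" "odd q"
      using q primes_dvd_imp_eq[of 2 q] by auto
    have qU: "q dvd ?U" using q U by simp
    have qV: "q dvd ?V"
      using s \<open>u \<noteq> 0\<close> _ q by (rule prime_dvd_cofactor_of_squarefree) (use k U in simp)
    have "\<not> q dvd e"
    proof
      assume "q dvd e"
      then have "q dvd A * r * e^2" by (simp add: power2_eq_square)
      then have "q dvd z^2" using qU by (simp only: dvd_add_left_iff)
      then show False using q \<open>q dvd e\<close> ndvd by (simp add: prime_dvd_power_iff)
    qed
    have "q dvd ?U - ?V" using qU qV by (rule dvd_diff)
    then have "q dvd (A - B) * r * e^2" by (simp add: algebra_simps)
    then have "q dvd A - B" using q q' \<open>\<not> q dvd e\<close> by (simp add: prime_dvd_mult_iff prime_dvd_power_iff)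
    then have "\<not> QuadRes q (- B * r)" using D q q' by (simp add: Legendre_neg_one_iff)
    moreover have "[z^2 = (- B * r) * e^2] (mod q)" using qV by (simp add: cong_iff_dvd_diff)
    ultimately show False using QuadRes_cancel q \<open>\<not> q dvd e\<close> by blast
  qed
  \<comment> \<open>Hence \<open>s = c * \<rho>\<close> up to sign, with \<open>c \<in> {1, 2}\<close> and \<open>\<rho> \<in> {1, r}\<close>.\<close>
  obtain s1 c where s1: "s = c * s1" "c = 1 \<or> c = 2" "squarefree s1"
      "\<And>q. prime q \<Longrightarrow> q dvd s1 \<Longrightarrow> q dvd s \<and> \<not> q dvd 2"
    using squarefree_strip_prime[OF s, of 2] by (metis abs_numeral two_is_prime)
  obtain v \<rho> where v: "s1 = \<rho> * v" "\<rho> = 1 \<or> \<rho> = r" "squarefree v"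
      "\<And>q. prime q \<Longrightarrow> q dvd v \<Longrightarrow> q dvd s1 \<and> \<not> q dvd r"
    using squarefree_strip_prime[OF s1(3), of r] assms(1) by (metis abs_of_pos prime_gt_0_int)
  have "v = 1 \<or> v = -1"
    using v(3) by (rule squarefree_no_prime_divisor) (meson v(4) s1(4) sdvd)
  then have form: "s = c * \<rho> \<or> s = - (c * \<rho>)" using s1 v by auto
  have "r > 0" using assms(1) by (simp add: prime_gt_0_int)
  have "u^2 dvd k^2" unfolding k U by simp
  then have "u dvd k" by simp
  then obtain l where l: "k = u * l" by blast
  have "u^2 * l^2 = k^2" by (simp add: l power_mult_distrib)
  also have "\<dots> = u^2 * (s * ?V)" unfolding k U by (simp only: mult_ac)
  finally have l2: "l^2 = s * ?V" using \<open>u \<noteq> 0\<close> by simp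
  have "l \<noteq> 0" using l \<open>k \<noteq> 0\<close> by auto

  have "s > 0"
  proof (rule ccontr)
    assume "\<not> s > 0"
    then have "s < 0" using s by (cases "s = 0") auto
    moreover have "s * ?V > 0" unfolding l2[symmetric] using \<open>l \<noteq> 0\<close> by simp
    ultimately have "?V < 0" by (simp only: zero_less_mult_iff) linarith
    moreover have "?U < 0" unfolding U using \<open>s < 0\<close> \<open>u \<noteq> 0\<close> by (simp add: mult_neg_pos)
    moreover have "A * r * e^2 \<ge> 0 \<or> B * r * e^2 \<ge> 0" using sgn \<open>r > 0\<close> by (auto intro: mult_nonneg_nonneg)
    moreover have "z^2 \<ge> 0" by simp
    ultimately show False by linarith
  qed
  then have s_eq: "s = c * \<rho>" using form s1(2) v(2) \<open>r > 0\<close> by auto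

  have "\<rho> = 1"
  proof (rule ccontr)
    assume "\<rho> \<noteq> 1"
    then have "r dvd s" using v(2) s_eq by simp
    then have "r dvd ?U" unfolding U by simp
    moreover have "r dvd A * r * e^2" by simp
    ultimately have "r dvd z^2" by (simp only: dvd_add_left_iff)
    then have "r dvd z" using assms(1) by (simp add: prime_dvd_power_iff)
    then obtain t where t: "z = r * t" by blast
    have "\<not> r dvd e" using ndvd assms(1) \<open>r dvd z\<close> by blast
    have "r * (r * t^2 + A * e^2) = r * (c * u^2)"
    proof -
      have "r * (r * t^2 + A * e^2) = ?U" unfolding t by (simp add: algebra_simps power2_eq_square)
      also have "\<dots> = r * (c * u^2)" unfolding U s_eq using v(2) \<open>\<rho> \<noteq> 1\<close> by simp
      finally show ?thesis .
    qed
    then have eq: "r * t^2 + A * e^2 = c * u^2" using \<open>r > 0\<close> by simp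
    have "QuadRes r c"
      using s1(2) QuadRes_two_of_7_mod_8[OF assms(1) r] unfolding QuadRes_def
      by (metis cong_refl one_power2)
    then obtain y where y: "[y^2 = c] (mod r)" by (auto simp: QuadRes_def)
    have "[(y * u)^2 = c * u^2] (mod r)"
      unfolding power_mult_distrib by (intro cong_mult y cong_refl)
    also have "[c * u^2 = A * e^2] (mod r)"
      unfolding eq[symmetric] by (simp add: cong_iff_dvd_diff)
    finally have "QuadRes r A" using QuadRes_cancel assms(1) \<open>\<not> r dvd e\<close> by blast
    then show False using A by (simp add: Legendre_neg_one_iff)
  qed
  have "c = 1"
  proof (rule ccontr)
    assume "c \<noteq> 1"
    then have "s = 2" using s1(2) s_eq \<open>\<rho> = 1\<close> by simp
    obtain i where "A * r = 7 + 8 * i" using cong_int_lin[OF a] by blast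
    then have "odd (A * r)" by simp
    moreover have "even ?U" using U \<open>s = 2\<close> by simp
    ultimately have "odd z" "odd e" using ndvd[of 2] by auto
    have "[?V = 1 + 5 * 1] (mod 8)"
      by (intro cong_add cong_mult b odd_square_cong_8 \<open>odd z\<close> \<open>odd e\<close>)
    then obtain j where "?V = 6 + 8 * j" by (auto dest!: cong_int_lin)
    then have "l^2 = 12 + 16 * j" using l2 \<open>s = 2\<close> by simp
    then have "l^2 mod 16 = 12" by simp
    then show False using square_mod_16[of l] by simp
  qed
  then have "s = 1" using s_eq \<open>\<rho> = 1\<close> by simp
  show "is_square ?U" using U \<open>s = 1\<close> by (auto intro: is_nth_powerI)
  show "is_square ?V" using l2 \<open>s = 1\<close> by (auto intro: is_nth_powerI[of _ l])
qed

section \<open>Infinite descent\<close>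

locale twist_hypotheses =
  fixes A B r :: int
  assumes prime_A: "prime \<bar>A\<bar>" and prime_B: "prime \<bar>B\<bar>"
    and A8: "[A = 1] (mod 8)" and B8: "[B = 3] (mod 8)"
    and signs: "A + B \<ge> 0 \<or> A * B < 0"
    and prime_r: "prime r" and r8: "[r = 7] (mod 8)"
    and Legendre_A: "Legendre A r = -1" and Legendre_B: "Legendre B r = -1"
    and Legendre_AB: "\<And>p. prime p \<Longrightarrow> odd p \<Longrightarrow> p dvd A - B \<Longrightarrow> Legendre (- B * r) p = -1"
begin

lemma Ar8: "[A * r = 7] (mod 8)"
  using cong_mult[OF A8 r8] by simp

lemma Br8: "[B * r = 5] (mod 8)"
  using cong_mult[OF B8 r8] by (simp add: cong_def)

lemma nonzero: "A \<noteq> 0" "B \<noteq> 0" "r \<noteq> 0"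
  using prime_A prime_B prime_r by auto

lemma A_neq_B: "A \<noteq> B"
  using A8 B8 by (auto simp: cong_def)

lemma positive: "A > 0 \<or> B > 0"
  using signs nonzero mult_neg_neg[of A B] by linarith

text \<open>For coprime \<open>z\<close>, \<open>w\<close> this says that \<open>x\<close>, \<open>x + A r\<close> and \<open>x + B r\<close> are all squares at
  \<open>x = (z / w)^2\<close>. These are the points on which the infinite descent operates.\<close>

definition square_pair :: "int \<Rightarrow> int \<Rightarrow> bool" where
  "square_pair z w \<longleftrightarrow> coprime z w \<and> w > 0 \<and>
     is_square (z^2 + A * r * w^2) \<and> is_square (z^2 + B * r * w^2)"

abbreviation "outside_2torsion \<equiv> x_outside_2torsion (of_int (A * r)) (of_int (B * r))"
abbreviation "dbl \<equiv> double_x (of_int (A * r)) (of_int (B * r))"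

text \<open>The local obstructions apply to integers: with \<open>x = m / e^2\<close> in lowest terms and \<open>d\<close>
  squarefree, \<open>m = d z^2\<close>, and \<open>z^2\<close> can be divided out of the equation of the curve.\<close>

lemma square_pair_of_square_class:
  assumes x: "outside_2torsion x" and xd: "x = of_int d * q^2" and d: "d \<in> {1, -1, A, -A}"
  obtains z w where "square_pair z w" "x = (of_int z / of_int w)^2"
proof -
  obtain m e n where e: "e > 0" "coprime m e" "x = of_int m / of_int (e^2)" "n \<noteq> 0"
      "n^2 = m * (m + A * r * e^2) * (m + B * r * e^2)"
    using x by (rule x_outside_2torsion_integral)
  have d0: "d \<noteq> 0" using d nonzero by auto
  have "(of_int d * q * of_int e)^2 = of_int (m * d)"
    using xd e(1,3) by (simp add: field_simps power2_eq_square)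
  then obtain k where k: "of_int d * q * of_int e = of_int k" by (rule rat_square_int)
  have "(of_int (m * d) :: rat) = of_int (k^2)"
    using \<open>(of_int d * q * of_int e)^2 = of_int (m * d)\<close> k by simp
  then have mk: "m * d = k^2" by (simp only: of_int_eq_iff)
  have "\<bar>d\<bar> = 1 \<or> prime \<bar>d\<bar>" using d prime_A by auto
  then have "\<bar>d\<bar> dvd k"
    using mk by (metis abs_dvd_iff dvd_triv_right one_dvd prime_dvd_power)
  then obtain z where z: "k = d * z" by (metis abs_dvd_iff dvdE)
  then have m: "m = d * z^2" using mk d0 by (simp add: power_mult_distrib power2_eq_square)
  have "z \<noteq> 0" using e(4,5) m by auto
  have cop: "coprime z e" using e(2) m by (metis coprime_mult_left_iff coprime_power_left_iff zero_neq_numeral)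
  let ?U = "d * z^2 + A * r * e^2" and ?V = "d * z^2 + B * r * e^2"
  have n2: "n^2 = z^2 * (d * ?U * ?V)" using e(5) unfolding m by (simp only: mult_ac)
  then have "z^2 dvd n^2" by simp
  then have "z dvd n" by simp
  then obtain l where l: "n = z * l" by blast
  then have "z^2 * l^2 = z^2 * (d * ?U * ?V)" using n2 by (simp only: power_mult_distrib)
  then have l2: "l^2 = d * ?U * ?V" using \<open>z \<noteq> 0\<close> by simp
  have "l \<noteq> 0" using l e(4) by auto
  have "d = 1"
  proof (rule ccontr)
    assume "d \<noteq> 1"
    then consider "[d = 7] (mod 8)" | "d = A"
      using d A8 cong_minus_minus_iff[of A 1 8] by (auto simp: cong_def)
    then show False
    proof cases
      case 1
      then show False using two_adic_obstruction[OF Ar8 Br8 1 cop l2] by blast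
    next
      case 2
      then show False using r_adic_obstruction[OF prime_r Legendre_A Legendre_B cop] l2 by blast
    qed
  qed
  then have "l^2 = (z^2 + A * r * e^2) * (z^2 + B * r * e^2)" using l2 by simp
  note trivial_square_class[OF prime_r Ar8 Br8 r8 Legendre_A Legendre_AB positive cop \<open>l \<noteq> 0\<close> this]
  then have "square_pair z e" using cop e(1) by (simp add: square_pair_def)
  moreover have "x = (of_int z / of_int e)^2" using e(3) m \<open>d = 1\<close> by (simp add: power_divide)
  ultimately show ?thesis by (rule that)
qed

text \<open>The two halves of the 2-descent combined: translation does not change the double, and the
  translate lies in the trivial square class.\<close>

lemma square_pair_with_same_double:
  assumes "outside_2torsion x"
  obtains z w where "square_pair z w" "outside_2torsion ((of_int z / of_int w)^2)"
    "dbl ((of_int z / of_int w)^2) = dbl x"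
proof -
  have "prime \<bar>r\<bar>" using prime_r prime_gt_0_int[OF prime_r] by simp
  obtain x' q d where x': "outside_2torsion x'" "dbl x' = dbl x" "x' = of_int d * q^2" "d \<in> {1, -1, A, -A}"
    using translate_square_class[OF prime_A prime_B \<open>prime \<bar>r\<bar>\<close> A_neq_B assms] by metis
  obtain z w where "square_pair z w" "x' = (of_int z / of_int w)^2"
    using x'(1,3,4) by (rule square_pair_of_square_class)
  then show ?thesis using that x'(1,2) by simp
qed

text \<open>For odd \<open>w\<close>, an even \<open>z\<close> makes \<open>z^2 + A r w^2\<close> congruent to \<open>3\<close> modulo \<open>4\<close>, and an odd \<open>z\<close> makes
  \<open>z^2 + B r w^2\<close> congruent to \<open>6\<close> modulo \<open>8\<close>.\<close>

lemma square_pair_even: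
  assumes "square_pair z w"
  shows "even w"
proof (rule ccontr)
  assume w: "odd w"
  obtain u v where u: "z^2 + A * r * w^2 = u^2" and v: "z^2 + B * r * w^2 = v^2"
    using assms by (auto simp: square_pair_def elim!: is_nth_powerE)
  show False
  proof (cases "even z")
    case True
    then obtain t where t: "z^2 = 4 * t" by (auto simp: power_mult_distrib elim!: evenE)
    have "[z^2 + A * r * w^2 = 4 * t + 7 * 1] (mod 8)"
      unfolding t by (intro cong_add cong_mult cong_refl Ar8 odd_square_cong_8 w)
    then obtain j where "u^2 = 4 * t + 7 + 8 * j" unfolding u by (auto dest!: cong_int_lin)
    then have "u^2 = 3 + 4 * (t + 1 + 2 * j)" by simp
    also have "[\<dots> = 3] (mod 4)" by (simp add: cong_iff_dvd_diff)
    finally have "u^2 mod 4 = 3" by (simp add: cong_def)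
    moreover have "u^2 mod 4 = u^2 mod 16 mod 4" by (simp add: mod_mod_cancel)
    ultimately show False using square_mod_16[of u] by auto
  next
    case False
    have "[z^2 + B * r * w^2 = 1 + 5 * 1] (mod 8)"
      by (intro cong_add cong_mult Br8 odd_square_cong_8 w False)
    then have "v^2 mod 8 = 6" unfolding v by (simp add: cong_def)
    moreover have "v^2 mod 8 = v^2 mod 16 mod 8" by (simp add: mod_mod_cancel)
    ultimately show False using square_mod_16[of v] by auto
  qed
qed

text \<open>The infinite descent. The point given by \<open>z / w\<close> is the double of one given by a pair
  \<open>z1\<close>, \<open>w1\<close> of the same kind. Since \<open>w1\<close> is even and \<open>z1\<close> odd, the numerator
  \<open>N = z1^4 - A B r^2 w1^4\<close> of the duplication formula is odd, while the denominator contains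
  \<open>2 w1\<close>; so \<open>w\<close> has a factor \<open>2\<close> that \<open>w1\<close> lacks.\<close>

lemma power_two_dvd_denominator:
  assumes "square_pair z w"
  shows "2^k dvd w"
  using assms
proof (induction k arbitrary: z w)
  case 0
  then show ?case by simp
next
  case (Suc k)
  let ?a = "of_int (A * r) :: rat" and ?b = "of_int (B * r) :: rat"
  have w: "w > 0" using Suc.prems by (simp add: square_pair_def)
  obtain u v where u: "z^2 + A * r * w^2 = u^2" and v: "z^2 + B * r * w^2 = v^2"
    using Suc.prems by (auto simp: square_pair_def elim!: is_nth_powerE)
  let ?x = "(of_int z / of_int w)^2 :: rat"
  have xa: "?x + ?a = (of_int u / of_int w)^2"
    using w arg_cong[OF u, of "of_int :: int \<Rightarrow> rat"] by (simp add: field_simps)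
  have xb: "?x + ?b = (of_int v / of_int w)^2"
    using w arg_cong[OF v, of "of_int :: int \<Rightarrow> rat"] by (simp add: field_simps)
  have ab: "?a \<noteq> 0" "?b \<noteq> 0" "?a \<noteq> ?b" using nonzero A_neq_B by auto
  obtain x' where x': "outside_2torsion x'" "dbl x' = ?x"
    using halving[OF ab refl xa xb] by blast
  obtain z1 w1 where p1: "square_pair z1 w1" and x1: "outside_2torsion ((of_int z1 / of_int w1)^2)"
      and dbl1: "dbl ((of_int z1 / of_int w1)^2) = ?x"
    using square_pair_with_same_double[OF x'(1)] x'(2) by metis
  have w1: "w1 > 0" "even w1" "odd z1"
    using p1 square_pair_even[OF p1] coprime_common_divisor[of z1 w1 2] by (auto simp: square_pair_def)
  obtain u1 v1 where u1: "z1^2 + A * r * w1^2 = u1^2" and v1: "z1^2 + B * r * w1^2 = v1^2"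
    using p1 by (auto simp: square_pair_def elim!: is_nth_powerE)
  let ?x1 = "(of_int z1 / of_int w1)^2 :: rat"
  define N M where "N = z1^4 - A * r * (B * r) * w1^4" and "M = 2 * w1 * (z1 * u1 * v1)"
  have xa1: "?x1 + ?a = (of_int u1 / of_int w1)^2"
    using w1(1) arg_cong[OF u1, of "of_int :: int \<Rightarrow> rat"] by (simp add: field_simps)
  have xb1: "?x1 + ?b = (of_int v1 / of_int w1)^2"
    using w1(1) arg_cong[OF v1, of "of_int :: int \<Rightarrow> rat"] by (simp add: field_simps)
  have "M \<noteq> 0"
    using x_outside_2torsion_nonzero[OF x1] w1(1) unfolding xa1 xb1 by (auto simp: M_def)
  have num: "?x1^2 - ?a * ?b = of_int N / of_int w1^4"
    using w1(1) by (simp add: N_def field_simps power_divide flip: power_mult)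
  have "?x = (of_int N / of_int M)^2"
    unfolding dbl1[symmetric] double_x_def num xa1 xb1 using w1(1)
    by (simp add: M_def power_divide power_mult_distrib field_simps eval_nat_numeral)
  then have "(of_int ((z * M)^2) :: rat) = of_int ((N * w)^2)"
    using w \<open>M \<noteq> 0\<close> by (simp add: field_simps)
  then have "(z * M)^2 = (N * w)^2" by (simp only: of_int_eq_iff)
  then have "N * w = z * M \<or> N * w = - (z * M)" by (auto simp: power2_eq_iff)
  moreover have "2 ^ Suc k dvd M" using Suc.IH[OF p1] by (simp add: M_def mult_dvd_mono)
  ultimately have "2 ^ Suc k dvd N * w" by auto
  moreover have "odd N" using w1(2,3) by (simp add: N_def)
  then have "coprime (2 ^ Suc k) N" by (simp del: power_Suc)
  ultimately show ?case by (simp only: coprime_dvd_mult_right_iff)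
qed

lemma no_point_outside_2torsion: "\<not> outside_2torsion x"
proof
  assume "outside_2torsion x"
  then obtain z w where zw: "square_pair z w" by (rule square_pair_with_same_double)
  have "w > 0" using zw by (simp add: square_pair_def)
  have "w < 2 ^ nat w" using \<open>w > 0\<close> less_exp[of "nat w"]
    by (metis int_nat_eq less_imp_le of_nat_less_iff of_nat_numeral of_nat_power)
  moreover have "2 ^ nat w \<le> w"
    using power_two_dvd_denominator[OF zw, of "nat w"] \<open>w > 0\<close> by (rule zdvd_imp_le)
  ultimately show False by simp
qed

end

theorem theorem2:
  fixes A B r :: int
  assumes "prime \<bar>A\<bar>" and "prime \<bar>B\<bar>"
    and "[A = 1] (mod 8)" and "[B = 3] (mod 8)"
    and "A + B \<ge> 0 \<or> A * B < 0"
    and "prime r" and "coprime r (A * B * (A - B))"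
    and "[r = 7] (mod 8)"
    and "Legendre A r = -1" and "Legendre B r = -1"
    and "\<And>p :: int. prime p \<Longrightarrow> odd p \<Longrightarrow> p dvd (A - B) \<Longrightarrow> Legendre (- B * r) p = -1"
  shows "mordell_weil_rank (quadratic_twist r (E_curve A B)) = 0"
proof -
  interpret twist_hypotheses A B r
    by unfold_locales (fact assms)+
  let ?E = "quadratic_twist r (E_curve A B)"
  have y0: "y = 0" if "on_curve ?E (Affine x y)" for x y
    using that no_point_outside_2torsion[of x] unfolding on_curve_twist_iff x_outside_2torsion_def by blast
  show ?thesis
    unfolding mordell_weil_rank_def
  proof (rule rank_zero_if_exponent_two)
    fix P assume "P \<in> carrier (mordell_weil_group ?E)"
    then have "on_curve ?E P" by (simp add: mordell_weil_group_def)
    then show "P \<otimes>\<^bsub>mordell_weil_group ?E\<^esub> P = \<one>\<^bsub>mordell_weil_group ?E\<^esub>"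
      using y0 by (cases P) (auto simp: mordell_weil_group_def)
  qed (simp_all add: mordell_weil_group_def)
qed

end
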